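(* Let $\Sigma=(\Gamma,\sigma)$ be a signed graph with underlying graph $\Gamma=(V,E)$, let $S$ be a finite set and $\iota:S\to S$ an involution, and let $t=|\{s\in S:\iota(s)=s\}|$. Then the number of proper $(S,\iota)$-colorings of $\Sigma$ is $$P_\Sigma(S,\iota)=(-1)^{|V|-k(\Sigma)}|S|^{k(\Sigma)}T_\Sigma\Big(1-|S|,0,1-\frac{t}{|S|}\Big).$$
   Context: A signed graph $\Sigma=(\Gamma,\sigma)$: finite graph $\Gamma=(V,E)$ (loops, multiple edges allowed), $\sigma:E\to\{-1,1\}$. A cycle (loops included) is balanced if the product of its edge signs is $1$, unbalanced otherwise. For $A\subseteq E$, $\Sigma\backslash A^c$ is the spanning signed subgraph $(V,A)$. $k,k_b,k_u$: numbers of connected components, balanced components, unbalanced components. Signed Tutte polynomial: $$T_\Sigma(X,Y,Z)=\sum_{A\subseteq E}(X-1)^{k(\Sigma\backslash A^c)-k(\Sigma)}(Y-1)^{|A|-|V|+k_b(\Sigma\backslash A^c)}(Z-1)^{k_u(\Sigma\backslash A^c)}.$$ A proper $(S,\iota)$-coloring of $\Sigma$ is a map $f:V\to S$ such that for every edge $e$ with endpoints $u,v$: $f(u)\ne f(v)$ if $e$ is positive, and $\iota(f(u))\ne f(v)$ if $e$ is negative. *)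

theory Defs
  imports Complex_Main "HOL-Library.FuncSet"
begin

text \<open>Edges are abstract names, so multiple edges are allowed; an edge whose set of endpoints is
  a singleton is a loop.\<close>

record ('v, 'e) sgraph =
  verts :: "'v set"
  edges :: "'e set"
  ends :: "'e \<Rightarrow> 'v set"
  sign :: "'e \<Rightarrow> int"

definition signed_graph :: "('v, 'e) sgraph \<Rightarrow> bool" where
  "signed_graph G \<longleftrightarrow>
     finite (verts G) \<and> finite (edges G) \<and>
     (\<forall>e\<in>edges G. \<exists>u\<in>verts G. \<exists>v\<in>verts G. ends G e = {u, v}) \<and>
     (\<forall>e\<in>edges G. sign G e \<in> {-1, 1})"

definition spanning_subgraph :: "('v, 'e) sgraph \<Rightarrow> 'e set \<Rightarrow> ('v, 'e) sgraph" where
  "spanning_subgraph G A = G\<lparr>edges := A\<rparr>"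

definition adj :: "('v, 'e) sgraph \<Rightarrow> ('v \<times> 'v) set" where
  "adj G = {(u, v). \<exists>e\<in>edges G. ends G e = {u, v}}"

text \<open>The vertex sets of the connected components.\<close>

definition components :: "('v, 'e) sgraph \<Rightarrow> 'v set set" where
  "components G = verts G // ((adj G)\<^sup>* \<inter> verts G \<times> verts G)"

text \<open>Length 1 gives a loop, length 2 a pair of distinct parallel edges.\<close>

definition is_cycle :: "('v, 'e) sgraph \<Rightarrow> 'v list \<Rightarrow> 'e list \<Rightarrow> bool" where
  "is_cycle G vs es \<longleftrightarrow>
     es \<noteq> [] \<and> length vs = length es \<and> distinct vs \<and> distinct es \<and>
     set vs \<subseteq> verts G \<and> set es \<subseteq> edges G \<and>
     (\<forall>i<length es. ends G (es ! i) = {vs ! i, vs ! (Suc i mod length vs)})"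

definition balanced_cycle :: "('v, 'e) sgraph \<Rightarrow> 'e list \<Rightarrow> bool" where
  "balanced_cycle G es \<longleftrightarrow> (\<Prod>e\<in>set es. sign G e) = 1"

definition balanced_component :: "('v, 'e) sgraph \<Rightarrow> 'v set \<Rightarrow> bool" where
  "balanced_component G C \<longleftrightarrow>
     (\<forall>vs es. is_cycle G vs es \<and> set vs \<subseteq> C \<longrightarrow> balanced_cycle G es)"

definition k_c :: "('v, 'e) sgraph \<Rightarrow> nat" where
  "k_c G = card (components G)"

definition k_b :: "('v, 'e) sgraph \<Rightarrow> nat" where
  "k_b G = card {C \<in> components G. balanced_component G C}"

definition k_u :: "('v, 'e) sgraph \<Rightarrow> nat" where
  "k_u G = card {C \<in> components G. \<not> balanced_component G C}"

text \<open>The exponents are formed in the integers, so that no difference is truncated.  They are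
  all nonnegative when \<open>G\<close> is a signed graph, so this is the value of a polynomial.\<close>

definition signed_tutte :: "('v, 'e) sgraph \<Rightarrow> 'a::field \<Rightarrow> 'a \<Rightarrow> 'a \<Rightarrow> 'a" where
  "signed_tutte G X Y Z =
     (\<Sum>A\<in>Pow (edges G).
        (X - 1) powi (int (k_c (spanning_subgraph G A)) - int (k_c G)) *
        (Y - 1) powi (int (card A) - int (card (verts G)) + int (k_b (spanning_subgraph G A))) *
        (Z - 1) powi int (k_u (spanning_subgraph G A)))"

definition involution_on :: "'s set \<Rightarrow> ('s \<Rightarrow> 's) \<Rightarrow> bool" where
  "involution_on S \<iota> \<longleftrightarrow> (\<forall>s\<in>S. \<iota> s \<in> S \<and> \<iota> (\<iota> s) = s)"

text \<open>Colorings are extensional functions, so that each map from the vertices to \<open>S\<close> is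
  counted once.\<close>

definition proper_colorings :: "('v, 'e) sgraph \<Rightarrow> 's set \<Rightarrow> ('s \<Rightarrow> 's) \<Rightarrow> ('v \<Rightarrow> 's) set" where
  "proper_colorings G S \<iota> =
     {f \<in> verts G \<rightarrow>\<^sub>E S.
        \<forall>e\<in>edges G. \<forall>u v. ends G e = {u, v} \<longrightarrow>
          (sign G e = 1 \<longrightarrow> f u \<noteq> f v) \<and> (sign G e = -1 \<longrightarrow> \<iota> (f u) \<noteq> f v)}"

end

theory Submission
  imports Defs
begin

text \<open>Inclusion--exclusion over the set of edges at which a coloring is improper reduces the count
  to colorings improper at every edge of a spanning subgraph. Along such an edge the color of one
  end determines that of the other, so such a coloring is determined by one color per component.
  By Harary's theorem a balanced component has a switching function turning all its signs
  positive, so any color is possible there. Going once around an unbalanced cycle forces a color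
  fixed by the involution, and then the coloring is constant on the component. So there are
  \<open>|S|^k_b * t^k_u\<close> such colorings, and up to sign this is the corresponding term of the
  Tutte polynomial.\<close>

section \<open>The action of signs on colors\<close>

definition sact :: "('s \<Rightarrow> 's) \<Rightarrow> int \<Rightarrow> 's \<Rightarrow> 's" where
  "sact \<iota> s x = (if s = 1 then x else \<iota> x)"

lemma sact_one [simp]: "sact \<iota> 1 x = x"
  by (simp add: sact_def)

lemma sact_fixed: "\<iota> x = x \<Longrightarrow> sact \<iota> s x = x"
  by (simp add: sact_def)

lemma sact_closed: "involution_on S \<iota> \<Longrightarrow> x \<in> S \<Longrightarrow> sact \<iota> s x \<in> S"
  by (simp add: sact_def involution_on_def)

lemma sact_mult:
  assumes "involution_on S \<iota>" "x \<in> S" "s \<in> {-1, 1}" "s' \<in> {-1, 1}"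
  shows "sact \<iota> (s * s') x = sact \<iota> s (sact \<iota> s' x)"
  using assms by (auto simp: sact_def involution_on_def)

text \<open>For signs in {-1, 1} these are the colorings improper at every edge. A positive loop
  imposes no condition, a negative loop forces a fixed point of \<open>\<iota>\<close>.\<close>

definition equivariant_colorings ::
    "('v, 'e) sgraph \<Rightarrow> 's set \<Rightarrow> ('s \<Rightarrow> 's) \<Rightarrow> ('v \<Rightarrow> 's) set" where
  "equivariant_colorings G S \<iota> =
     {f \<in> verts G \<rightarrow>\<^sub>E S.
        \<forall>e\<in>edges G. \<forall>u v. ends G e = {u, v} \<longrightarrow> f v = sact \<iota> (sign G e) (f u)}"

lemma signed_graph_spanning_subgraph:
  "signed_graph G \<Longrightarrow> A \<subseteq> edges G \<Longrightarrow> signed_graph (spanning_subgraph G A)"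
  unfolding signed_graph_def spanning_subgraph_def by (auto intro: finite_subset)

lemma spanning_subgraph_simps [simp]:
  "verts (spanning_subgraph G A) = verts G" "edges (spanning_subgraph G A) = A"
  "ends (spanning_subgraph G A) = ends G" "sign (spanning_subgraph G A) = sign G"
  by (simp_all add: spanning_subgraph_def)

subsection \<open>Harary's balance theorem\<close>

text \<open>Membership in \<open>verts G\<close> is left out because the reflexive closure of
  \<open>adj G\<close> relates every point to itself, so trivial paths must exist
  everywhere.\<close>

definition simple_path :: "('v, 'e) sgraph \<Rightarrow> 'v list \<Rightarrow> 'e list \<Rightarrow> bool" where
  "simple_path G vs es \<longleftrightarrow>
     length vs = Suc (length es) \<and> distinct vs \<and> set es \<subseteq> edges G \<and>
     (\<forall>i<length es. ends G (es ! i) = {vs ! i, vs ! Suc i})"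

text \<open>Append the last edge of the walk, or cut the path back if its new vertex was already
  visited.\<close>

lemma rtrancl_adj_simple_path:
  assumes "(u, v) \<in> (adj G)\<^sup>*"
  shows "\<exists>vs es. simple_path G vs es \<and> vs ! 0 = u \<and> vs ! length es = v"
  using assms
proof (induction rule: rtrancl_induct)
  case base
  show ?case by (intro exI[of _ "[u]"] exI[of _ "[]"]) (simp add: simple_path_def)
next
  case (step v w)
  obtain vs es where p: "simple_path G vs es" "vs ! 0 = u" "vs ! length es = v"
    using step.IH by blast
  obtain e where e: "e \<in> edges G" "ends G e = {v, w}"
    using step.hyps(2) by (auto simp: adj_def)
  show ?case
  proof (cases "w \<in> set vs")
    case True
    then obtain k where k: "k < length vs" "vs ! k = w" by (auto simp: in_set_conv_nth)
    \<comment> \<open>Position \<open>k\<close> is the earlier visit to \<open>w\<close>: keeping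
      \<open>Suc k\<close> vertices and \<open>k\<close> edges ends the path there.\<close>
    with p show ?thesis
      by (intro exI[of _ "take (Suc k) vs"] exI[of _ "take k es"])
         (auto simp: simple_path_def dest: in_set_takeD)
  next
    case False
    have "simple_path G (vs @ [w]) (es @ [e])"
      using p e False by (auto simp: simple_path_def nth_append less_Suc_eq)
    with p show ?thesis
      by (intro exI[of _ "vs @ [w]"] exI[of _ "es @ [e]"])
         (auto simp: simple_path_def nth_append)
  qed
qed

text \<open>A repeated edge would have the same ends at positions \<open>i < j\<close>, but
  \<open>vs ! i\<close> differs from both ends at position \<open>j\<close>.\<close>

lemma simple_path_distinct_edges:
  assumes "simple_path G vs es"
  shows "distinct es"
proof -
  have "es ! i \<noteq> es ! j" if "i < j" "j < length es" for i j
  proof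
    assume "es ! i = es ! j"
    moreover have "ends G (es ! i) = {vs ! i, vs ! Suc i}" "ends G (es ! j) = {vs ! j, vs ! Suc j}"
      using assms that by (simp_all add: simple_path_def)
    ultimately have "{vs ! i, vs ! Suc i} = {vs ! j, vs ! Suc j}" by simp
    moreover have "vs ! i \<noteq> vs ! j" "vs ! i \<noteq> vs ! Suc j"
      using assms that by (auto simp: simple_path_def nth_eq_iff_index_eq)
    ultimately show False by blast
  qed
  then show ?thesis
    unfolding distinct_conv_nth by (metis nat_neq_iff)
qed

text \<open>Every interior \<open>p i\<close> occurs twice and squares to 1.\<close>

lemma prod_telescope_sign:
  fixes p :: "nat \<Rightarrow> int"
  assumes "\<And>i. p i \<in> {-1, 1}" "\<And>i. i < n \<Longrightarrow> s i = p i * p (Suc i)"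
  shows "(\<Prod>i<n. s i) = p 0 * p n"
  using assms(2)
proof (induction n)
  case 0
  show ?case using assms(1)[of 0] by auto
next
  case (Suc n)
  then show ?case using assms(1)[of n] by auto
qed

lemma prod_set_nth:
  "distinct es \<Longrightarrow> (\<Prod>e\<in>set es. f e) = (\<Prod>i<length es. f (es ! i))"
  by (rule prod.reindex_bij_betw[symmetric], rule bij_betw_nth) auto

lemma is_cycle_mono:
  "is_cycle (G\<lparr>edges := A\<rparr>) vs es \<Longrightarrow> A \<subseteq> B \<Longrightarrow> is_cycle (G\<lparr>edges := B\<rparr>) vs es"
  by (auto simp: is_cycle_def)

text \<open>Freshness of \<open>e\<close> keeps the edges distinct. The trivial path closes to a
  loop, a path of one edge to a pair of parallel edges.\<close>

lemma closing_edge_is_cycle: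
  assumes "simple_path (G\<lparr>edges := B\<rparr>) vs es" "e \<notin> B" "set vs \<subseteq> verts G"
    and "ends G e = {vs ! length es, vs ! 0}"
  shows "is_cycle (G\<lparr>edges := insert e B\<rparr>) vs (es @ [e])"
proof -
  have "ends G ((es @ [e]) ! i) = {vs ! i, vs ! (Suc i mod length vs)}" if "i < Suc (length es)" for i
    using assms(1,4) that by (cases "i = length es") (simp_all add: simple_path_def nth_append)
  then show ?thesis
    using assms(1-3) simple_path_distinct_edges[OF assms(1)]
    by (auto simp: is_cycle_def simple_path_def)
qed

lemma simple_path_verts:
  assumes "simple_path G vs es" "vs ! 0 \<in> verts G"
    and "\<And>e. e \<in> edges G \<Longrightarrow> ends G e \<subseteq> verts G"
  shows "set vs \<subseteq> verts G"
proof
  fix x assume "x \<in> set vs"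
  then obtain i where i: "i < length vs" "x = vs ! i" by (auto simp: in_set_conv_nth)
  show "x \<in> verts G"
  proof (cases i)
    case 0
    then show ?thesis using i assms by simp
  next
    case (Suc j)
    then have "es ! j \<in> edges G" "x \<in> ends G (es ! j)"
      using assms(1) i by (auto simp: simple_path_def)
    then show ?thesis using assms(3) by blast
  qed
qed

text \<open>The edges are added one at a time. If the new edge disagrees with the current
  \<open>p\<close>, balance forces its ends into different components of the earlier edges, and
  negating \<open>p\<close> on one of them repairs it.\<close>

lemma balanced_imp_switching_function:
  fixes G :: "('v, 'e) sgraph"
  assumes "finite B"
    and "\<And>e. e \<in> B \<Longrightarrow> \<exists>u\<in>verts G. \<exists>v\<in>verts G. ends G e = {u, v}"
    and "\<And>e. e \<in> B \<Longrightarrow> sign G e \<in> {-1, 1}"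
    and "\<And>vs es. is_cycle (G\<lparr>edges := B\<rparr>) vs es \<Longrightarrow> balanced_cycle G es"
  shows "\<exists>p. (\<forall>v. p v \<in> {-1, 1}) \<and>
    (\<forall>e\<in>B. \<forall>u v. ends G e = {u, v} \<longrightarrow> sign G e = p u * p v)"
  using assms
proof (induction B rule: finite_induct)
  case empty
  show ?case by (intro exI[of _ "\<lambda>_. 1"]) simp
next
  case (insert e B)
  have "\<exists>p. (\<forall>v. p v \<in> {-1, 1}) \<and>
    (\<forall>e\<in>B. \<forall>u v. ends G e = {u, v} \<longrightarrow> sign G e = p u * p v)"
  proof (rule insert.IH)
    fix vs es assume "is_cycle (G\<lparr>edges := B\<rparr>) vs es"
    then show "balanced_cycle G es" by (rule insert.prems(3)[OF is_cycle_mono[OF _ subset_insertI]])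
  qed (use insert.prems in auto)
  then obtain p where p: "\<And>v. p v \<in> {-1, 1::int}"
    and pB: "\<And>e u v. e \<in> B \<Longrightarrow> ends G e = {u, v} \<Longrightarrow> sign G e = p u * p v"
    by blast
  obtain a b where ab: "a \<in> verts G" "b \<in> verts G" "ends G e = {a, b}"
    using insert.prems(1)[of e] by auto
  have se: "sign G e \<in> {-1, 1}" using insert.prems(2)[of e] by auto
  let ?B = "G\<lparr>edges := B\<rparr>"
  show ?case
  proof (cases "sign G e = p a * p b")
    case True
    then show ?thesis
      using p pB ab by (intro exI[of _ p]) (auto simp: doubleton_eq_iff)
  next
    case False
    \<comment> \<open>By telescoping, a path from \<open>a\<close> to \<open>b\<close> has sign
      \<open>p a * p b\<close>; the cycle closed by \<open>e\<close> is balanced, so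
      \<open>e\<close> would have this sign too. If \<open>e\<close> is a loop, the trivial path
      serves.\<close>
    have nconn: "(a, b) \<notin> (adj ?B)\<^sup>*"
    proof
      assume "(a, b) \<in> (adj ?B)\<^sup>*"
      then obtain vs es where P: "simple_path ?B vs es" "vs ! 0 = a" "vs ! length es = b"
        using rtrancl_adj_simple_path by metis
      have "set vs \<subseteq> verts ?B"
        using P ab insert.prems(1) by (intro simple_path_verts[OF P(1)]) fastforce+
      then have "is_cycle (G\<lparr>edges := insert e B\<rparr>) vs (es @ [e])"
        using P ab insert.hyps(2) by (intro closing_edge_is_cycle) auto
      then have bal: "balanced_cycle G (es @ [e])" by (rule insert.prems(3))
      have "e \<notin> set es" using P insert.hyps(2) by (auto simp: simple_path_def)
      then have "1 = sign G e * (\<Prod>e\<in>set es. sign G e)"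
        using bal by (simp add: balanced_cycle_def)
      also have "(\<Prod>e\<in>set es. sign G e) = (\<Prod>i<length es. sign G (es ! i))"
        by (rule prod_set_nth[OF simple_path_distinct_edges[OF P(1)]])
      also have "\<dots> = p (vs ! 0) * p (vs ! length es)"
        using P(1) by (intro prod_telescope_sign p pB) (auto simp: simple_path_def)
      finally show False using False P se p[of a] p[of b] by auto
    qed
    \<comment> \<open>Switching on the component of \<open>a\<close>: an edge of \<open>B\<close>
      has both ends inside or both outside, so its product is unchanged, whereas \<open>b\<close>
      lies outside and the product at \<open>e\<close> changes sign.\<close>
    define q where "q v = (if (a, v) \<in> (adj ?B)\<^sup>* then - p v else p v)" for v
    have qB: "sign G e' = q u * q v" if "e' \<in> B" "ends G e' = {u, v}" for e' u v
    proof -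
      have "(u, v) \<in> adj ?B" "(v, u) \<in> adj ?B"
        using that by (auto simp: adj_def insert_commute)
      then have "(a, u) \<in> (adj ?B)\<^sup>* \<longleftrightarrow> (a, v) \<in> (adj ?B)\<^sup>*"
        by (meson rtrancl.rtrancl_into_rtrancl)
      then show ?thesis using pB[OF that] by (simp add: q_def)
    qed
    have "sign G e = q a * q b"
      using nconn False se p[of a] p[of b] by (auto simp: q_def)
    moreover have "q v \<in> {-1, 1}" for v using p[of v] by (auto simp: q_def)
    ultimately show ?thesis
      using qB ab by (intro exI[of _ q]) (auto simp: doubleton_eq_iff)
  qed
qed

subsection \<open>Colorings that are improper at every edge\<close>

lemma equiv_connected:
  "equiv (verts G) ((adj G)\<^sup>* \<inter> verts G \<times> verts G)"
proof -
  have "sym (adj G)" by (auto simp: sym_def adj_def insert_commute)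
  then have "sym ((adj G)\<^sup>*)" by (rule sym_rtrancl)
  then show ?thesis
    by (intro equivI refl_onI sym_Int trans_Restr trans_rtrancl) (auto simp: sym_def)
qed

lemma components_subset: "C \<in> components G \<Longrightarrow> C \<subseteq> verts G"
  by (auto simp: components_def quotient_def)

lemma Union_components: "\<Union>(components G) = verts G"
  unfolding components_def by (rule Union_quotient[OF equiv_connected])

lemma component_nonempty: "C \<in> components G \<Longrightarrow> C \<noteq> {}"
  unfolding components_def by (rule in_quotient_imp_non_empty[OF equiv_connected])

lemma components_eq:
  "C \<in> components G \<Longrightarrow> D \<in> components G \<Longrightarrow> v \<in> C \<Longrightarrow> v \<in> D \<Longrightarrow> C = D"
  unfolding components_def using quotient_disj[OF equiv_connected] by fast

lemma component_connected:
  "C \<in> components G \<Longrightarrow> u \<in> C \<Longrightarrow> v \<in> C \<Longrightarrow> (u, v) \<in> (adj G)\<^sup>*"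
  unfolding components_def using in_quotient_imp_in_rel[OF equiv_connected, of C G u v] by simp

lemma finite_components: "signed_graph G \<Longrightarrow> finite (components G)"
  unfolding components_def signed_graph_def by (intro finite_quotient) auto

text \<open>Ensures that the natural-number exponent \<open>card (verts G) - k_c G\<close> is not
  truncated.\<close>

lemma k_c_le_card_verts: "signed_graph G \<Longrightarrow> k_c G \<le> card (verts G)"
proof -
  assume "signed_graph G"
  then have "finite (verts G)" by (simp add: signed_graph_def)
  moreover have "components G =
      (\<lambda>v. ((adj G)\<^sup>* \<inter> verts G \<times> verts G) `` {v}) ` verts G"
    by (auto simp: components_def quotient_def)
  ultimately show ?thesis unfolding k_c_def by (metis card_image_le)
qed

lemma signed_graph_ends_in_verts:
  "signed_graph G \<Longrightarrow> e \<in> edges G \<Longrightarrow> ends G e = {u, v} \<Longrightarrow> u \<in> verts G \<and> v \<in> verts G"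
  unfolding signed_graph_def by (metis doubleton_eq_iff)

lemma component_closed:
  assumes "signed_graph G" "C \<in> components G" "e \<in> edges G" "ends G e = {u, v}" "u \<in> C"
  shows "v \<in> C"
proof -
  have "(u, v) \<in> (adj G)\<^sup>* \<inter> verts G \<times> verts G"
    using assms signed_graph_ends_in_verts[of G e u v] by (auto simp: adj_def)
  then show ?thesis
    using assms(2,5) in_quotient_imp_closed[OF equiv_connected] unfolding components_def by fast
qed

section \<open>Rigidity of equivariant colorings along paths and cycles\<close>

lemma equivariant_determined:
  assumes "f \<in> equivariant_colorings G S \<iota>" "g \<in> equivariant_colorings G S \<iota>"
    and "(u, v) \<in> (adj G)\<^sup>*" "f u = g u"
  shows "f v = g v"
  using assms(3,4)
proof (induction rule: rtrancl_induct)
  case (step v w)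
  then obtain e where "e \<in> edges G" "ends G e = {v, w}" by (auto simp: adj_def)
  then have "f w = sact \<iota> (sign G e) (f v)" "g w = sact \<iota> (sign G e) (g v)"
    using assms(1,2) by (auto simp: equivariant_colorings_def)
  then show ?case using step by simp
qed

text \<open>A fixed point of \<open>\<iota>\<close> is unchanged by either sign, so it spreads along
  the path.\<close>

lemma equivariant_constant_if_fixed:
  assumes "f \<in> equivariant_colorings G S \<iota>"
    and "(u, v) \<in> (adj G)\<^sup>*" "\<iota> (f u) = f u"
  shows "f v = f u"
  using assms(2)
proof (induction rule: rtrancl_induct)
  case (step v w)
  then obtain e where "e \<in> edges G" "ends G e = {v, w}" by (auto simp: adj_def)
  then have "f w = sact \<iota> (sign G e) (f v)"
    using assms(1) by (auto simp: equivariant_colorings_def)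
  then show ?case using step assms(3) by (simp add: sact_fixed)
qed simp

text \<open>Transport once around the cycle acts by the product of its signs, here -1, and returns
  to the starting vertex.\<close>

lemma unbalanced_cycle_fixed:
  assumes G: "signed_graph G" and inv: "involution_on S \<iota>"
    and f: "f \<in> equivariant_colorings G S \<iota>"
    and cyc: "is_cycle G vs es" and unbal: "\<not> balanced_cycle G es"
  shows "\<iota> (f (vs ! 0)) = f (vs ! 0)"
proof -
  let ?n = "length es"
  let ?s = "\<lambda>i. \<Prod>j<i. sign G (es ! j)"
  have es: "es ! i \<in> edges G" if "i < ?n" for i
    using cyc that by (auto simp: is_cycle_def)
  have sgn: "sign G (es ! i) \<in> {-1, 1}" if "i < ?n" for i
    using G es[OF that] by (auto simp: signed_graph_def)
  have sgn_prod: "?s i \<in> {-1, 1}" if "i \<le> ?n" for i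
    using that
  proof (induction i)
    case (Suc i)
    then show ?case using sgn[of i] by auto
  qed simp
  have "vs ! 0 \<in> verts G"
    using cyc nth_mem[of 0 vs] by (auto simp: is_cycle_def)
  then have fS: "f (vs ! 0) \<in> S"
    using f by (auto simp: equivariant_colorings_def)
  \<comment> \<open>The index is reduced modulo \<open>?n\<close> so that the invariant at
    \<open>i = ?n\<close> includes the closing edge.\<close>
  have "f (vs ! (i mod ?n)) = sact \<iota> (?s i) (f (vs ! 0))" if "i \<le> ?n" for i
    using that
  proof (induction i)
    case (Suc i)
    then have i: "i < ?n" by simp
    have "ends G (es ! i) = {vs ! i, vs ! (Suc i mod ?n)}"
      using cyc i by (simp add: is_cycle_def)
    then have "f (vs ! (Suc i mod ?n)) = sact \<iota> (sign G (es ! i)) (f (vs ! i))"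
      using f es[OF i] by (auto simp: equivariant_colorings_def)
    also have "\<dots> = sact \<iota> (sign G (es ! i)) (sact \<iota> (?s i) (f (vs ! 0)))"
      using Suc i by simp
    also have "\<dots> = sact \<iota> (sign G (es ! i) * ?s i) (f (vs ! 0))"
      by (rule sact_mult[symmetric, OF inv fS sgn[OF i] sgn_prod]) (use i in simp)
    finally show ?case by (simp add: mult.commute)
  qed simp
  from this[of ?n] have "f (vs ! 0) = sact \<iota> (?s ?n) (f (vs ! 0))" by simp
  \<comment> \<open>Being different from 1 is enough, since \<open>sact\<close> then applies
    \<open>\<iota>\<close>.\<close>
  moreover have "?s ?n \<noteq> 1"
    using unbal cyc by (simp add: balanced_cycle_def prod_set_nth is_cycle_def)
  ultimately show ?thesis by (simp add: sact_def)
qed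

text \<open>An unbalanced cycle gives a fixed color at one vertex, and connectedness carries it to
  \<open>v\<close>.\<close>

lemma unbalanced_component_fixed:
  assumes "signed_graph G" "involution_on S \<iota>" "f \<in> equivariant_colorings G S \<iota>"
    and "C \<in> components G" "\<not> balanced_component G C" "v \<in> C"
  shows "\<iota> (f v) = f v"
proof -
  obtain vs es where cyc: "is_cycle G vs es" "set vs \<subseteq> C" "\<not> balanced_cycle G es"
    using assms(5) by (auto simp: balanced_component_def)
  have fixed: "\<iota> (f (vs ! 0)) = f (vs ! 0)"
    by (rule unbalanced_cycle_fixed[OF assms(1-3) cyc(1,3)])
  have "vs ! 0 \<in> C" using cyc nth_mem[of 0 vs] by (auto simp: is_cycle_def)
  then have "f v = f (vs ! 0)"
    using equivariant_constant_if_fixed[OF assms(3) _ fixed] component_connected assms(4,6) by metis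
  with fixed show ?thesis by simp
qed

text \<open>Supplies surjectivity in the count below: a constant coloring serves if \<open>x\<close>
  is fixed, a switching function if the component is balanced. Only edges at \<open>C\<close> are
  constrained, so that solutions for different components can be glued.\<close>

lemma component_coloring_exists:
  assumes G: "signed_graph G" and inv: "involution_on S \<iota>"
    and C: "C \<in> components G"
    and x: "x \<in> (if balanced_component G C then S else {s \<in> S. \<iota> s = s})"
  shows "\<exists>g. g r = x \<and> (\<forall>v. g v \<in> S) \<and>
    (\<forall>e\<in>edges G. \<forall>u v. ends G e = {u, v} \<longrightarrow> u \<in> C \<longrightarrow> g v = sact \<iota> (sign G e) (g u))"
proof (cases "balanced_component G C")
  case False
  with x show ?thesis by (intro exI[of _ "\<lambda>_. x"]) (simp add: sact_fixed)
next
  case True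
  \<comment> \<open>With only the edges inside \<open>C\<close>, each vertex of a cycle is an end of
    such an edge, so the cycle lies in \<open>C\<close> and balance of \<open>C\<close> applies to
    it.\<close>
  let ?B = "{e \<in> edges G. ends G e \<subseteq> C}"
  have "\<exists>p. (\<forall>v. p v \<in> {-1, 1}) \<and>
    (\<forall>e\<in>?B. \<forall>u v. ends G e = {u, v} \<longrightarrow> sign G e = p u * p v)"
  proof (rule balanced_imp_switching_function)
    fix vs es assume cyc: "is_cycle (G\<lparr>edges := ?B\<rparr>) vs es"
    have "set vs \<subseteq> C"
    proof
      fix y assume "y \<in> set vs"
      then obtain i where "i < length vs" "y = vs ! i" by (auto simp: in_set_conv_nth)
      then have "es ! i \<in> ?B" "y \<in> ends G (es ! i)"
        using cyc nth_mem[of i es] by (auto simp: is_cycle_def simp del: nth_mem)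
      then show "y \<in> C" by blast
    qed
    moreover have "is_cycle G vs es" using cyc by (auto simp: is_cycle_def)
    ultimately show "balanced_cycle G es" using True by (auto simp: balanced_component_def)
  qed (use G in \<open>auto simp: signed_graph_def\<close>)
  then obtain p where p: "\<And>v. p v \<in> {-1, 1::int}"
    and pB: "\<forall>e\<in>?B. \<forall>u v. ends G e = {u, v} \<longrightarrow> sign G e = p u * p v"
    by blast
  have xS: "x \<in> S" using x True by simp
  \<comment> \<open>The factor \<open>p r\<close> normalizes the switching function so that
    \<open>r\<close> receives exactly \<open>x\<close>.\<close>
  define g where "g v = sact \<iota> (p v * p r) x" for v
  have "g r = x" using p[of r] by (auto simp: g_def)
  moreover have "\<forall>v. g v \<in> S" by (simp add: g_def sact_closed[OF inv xS])
  moreover have "g v = sact \<iota> (sign G e) (g u)"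
    if "e \<in> edges G" "ends G e = {u, v}" "u \<in> C" for e u v
  proof -
    have "v \<in> C" using component_closed[OF G C] that by blast
    then have "e \<in> ?B" using that by simp
    then have s: "sign G e = p u * p v" using pB that(2) by blast
    have "sact \<iota> (sign G e) (g u) = sact \<iota> (sign G e * (p u * p r)) x"
      unfolding g_def using p[of u] p[of r] p[of v] s
      by (intro sact_mult[symmetric, OF inv xS]) auto
    also have "sign G e * (p u * p r) = p v * p r"
      using p[of u] s by auto
    finally show ?thesis by (simp add: g_def)
  qed
  ultimately show ?thesis by blast
qed

text \<open>Reading off the color at one root per component is a bijection onto the admissible
  choices: any color on a balanced component, a fixed one on an unbalanced component.\<close>

lemma card_equivariant_colorings:
  assumes G: "signed_graph G" and inv: "involution_on S \<iota>"
  shows "card (equivariant_colorings G S \<iota>) = card S ^ k_b G * card {s \<in> S. \<iota> s = s} ^ k_u G"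
proof -
  let ?K = "components G"
  let ?T = "\<lambda>C. if balanced_component G C then S else {s \<in> S. \<iota> s = s}"
  let ?E = "equivariant_colorings G S \<iota>"
  define root where "root C = (SOME v. v \<in> C)" for C :: "'a set"
  have root: "root C \<in> C" if "C \<in> ?K" for C
    using component_nonempty[OF that] by (auto simp: root_def intro: someI_ex)
  \<comment> \<open>The restriction to \<open>?K\<close> makes the values extensional, as
    \<open>PiE\<close> requires.\<close>
  define \<Phi> where "\<Phi> f = (\<lambda>C\<in>?K. f (root C))" for f :: "'a \<Rightarrow> 'c"
  have "bij_betw \<Phi> ?E (PiE ?K ?T)"
    unfolding bij_betw_def
  proof
    show "inj_on \<Phi> ?E"
    proof (rule inj_onI)
      fix f g assume f: "f \<in> ?E" and g: "g \<in> ?E" and eq: "\<Phi> f = \<Phi> g"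
      have "f v = g v" if "v \<in> verts G" for v
      proof -
        obtain C where C: "C \<in> ?K" "v \<in> C" using \<open>v \<in> verts G\<close> Union_components[of G] by blast
        have "f (root C) = g (root C)" using fun_cong[OF eq, of C] C by (simp add: \<Phi>_def)
        then show ?thesis
          using equivariant_determined[OF f g] component_connected[OF C(1) root[OF C(1)] C(2)] by blast
      qed
      then show "f = g"
        using f g by (auto simp: equivariant_colorings_def intro: PiE_ext)
    qed
    show "\<Phi> ` ?E = PiE ?K ?T"
    proof
      show "\<Phi> ` ?E \<subseteq> PiE ?K ?T"
      proof (clarify, rule PiE_I)
        fix f C assume f: "f \<in> ?E" and C: "C \<in> ?K"
        have "f (root C) \<in> S"
          using f root[OF C] components_subset[OF C] by (auto simp: equivariant_colorings_def)
        then show "\<Phi> f C \<in> ?T C"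
          using C unbalanced_component_fixed[OF G inv f C _ root[OF C]] by (simp add: \<Phi>_def)
      qed (simp add: \<Phi>_def)
      show "PiE ?K ?T \<subseteq> \<Phi> ` ?E"
      proof
        fix s assume s: "s \<in> PiE ?K ?T"
        have "\<forall>C\<in>?K. \<exists>g. g (root C) = s C \<and> (\<forall>v. g v \<in> S) \<and>
          (\<forall>e\<in>edges G. \<forall>u v. ends G e = {u, v} \<longrightarrow> u \<in> C \<longrightarrow> g v = sact \<iota> (sign G e) (g u))"
          by (intro ballI component_coloring_exists[OF G inv] PiE_mem[OF s])
        then obtain g where g: "\<And>C. C \<in> ?K \<Longrightarrow> g C (root C) = s C"
          "\<And>C v. C \<in> ?K \<Longrightarrow> g C v \<in> S"
          "\<And>C e u v. C \<in> ?K \<Longrightarrow> e \<in> edges G \<Longrightarrow> ends G e = {u, v} \<Longrightarrow> u \<in> C \<Longrightarrow>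
             g C v = sact \<iota> (sign G e) (g C u)"
          by metis
        \<comment> \<open>Glue the chosen colorings: each vertex follows that of its own component,
          which is unique by disjointness.\<close>
        define f where "f = (\<lambda>v\<in>verts G. g (THE C. C \<in> ?K \<and> v \<in> C) v)"
        have f_eq: "f v = g C v" if "C \<in> ?K" "v \<in> C" for C v
        proof -
          have "(THE C. C \<in> ?K \<and> v \<in> C) = C"
          proof (rule the_equality)
            show "D = C" if "D \<in> ?K \<and> v \<in> D" for D
              using that \<open>C \<in> ?K\<close> \<open>v \<in> C\<close> components_eq[of D G C v] by simp
          qed (use that in simp)
          then show ?thesis using that components_subset[of C G] by (auto simp: f_def)
        qed
        have "f \<in> ?E"
          unfolding equivariant_colorings_def
        proof (intro CollectI conjI PiE_I ballI allI impI)
          fix v assume "v \<in> verts G"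
          then obtain C where "C \<in> ?K" "v \<in> C" using Union_components[of G] by blast
          then show "f v \<in> S" using f_eq g(2) by simp
        next
          fix e u v assume e: "e \<in> edges G" "ends G e = {u, v}"
          then obtain C where C: "C \<in> ?K" "u \<in> C"
            using Union_components[of G] signed_graph_ends_in_verts[OF G] by blast
          then have "v \<in> C" using component_closed[OF G] e by blast
          then show "f v = sact \<iota> (sign G e) (f u)" using f_eq g(3) C e by simp
        qed (simp add: f_def)
        moreover have "\<Phi> f = s"
        proof
          fix C show "\<Phi> f C = s C"
          proof (cases "C \<in> ?K")
            case True
            then show ?thesis by (simp add: \<Phi>_def f_eq[OF True root[OF True]] g(1))
          next
            case False
            then show ?thesis using PiE_arb[OF s False] by (simp add: \<Phi>_def)
          qed
        qed
        ultimately show "s \<in> \<Phi> ` ?E" by blast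
      qed
    qed
  qed
  then have "card ?E = card (PiE ?K ?T)" by (rule bij_betw_same_card)
  also have "\<dots> = (\<Prod>C\<in>?K. card (?T C))" by (rule card_PiE[OF finite_components[OF G]])
  also have "\<dots> = (\<Prod>C\<in>?K. if balanced_component G C then card S else card {s \<in> S. \<iota> s = s})"
    by (intro prod.cong) auto
  also have "\<dots> = card S ^ k_b G * card {s \<in> S. \<iota> s = s} ^ k_u G"
  proof -
    have "?K \<inter> {C. balanced_component G C} = {C \<in> ?K. balanced_component G C}"
      and "?K \<inter> - {C. balanced_component G C} = {C \<in> ?K. \<not> balanced_component G C}"
      by auto
    then show ?thesis
      by (simp only: prod.If_cases[OF finite_components[OF G]] prod_constant k_b_def k_u_def)
  qed
  finally show ?thesis .
qed

subsection \<open>Inclusion--exclusion\<close>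

text \<open>Both conditions quantify universally over the two orders of the ends, so they are
  complementary only because \<open>\<iota>\<close> is an involution and the orders agree.\<close>

lemma equivariant_at_edge_iff:
  assumes inv: "involution_on S \<iota>" and "f u \<in> S" "f v \<in> S"
    and "s \<in> {-1, 1}" "ends G e = {u, v}"
  shows "(\<forall>u v. ends G e = {u, v} \<longrightarrow> f v = sact \<iota> s (f u)) \<longleftrightarrow> f v = sact \<iota> s (f u)"
    and "(\<forall>u v. ends G e = {u, v} \<longrightarrow> (s = 1 \<longrightarrow> f u \<noteq> f v) \<and> (s = -1 \<longrightarrow> \<iota> (f u) \<noteq> f v))
      \<longleftrightarrow> f v \<noteq> sact \<iota> s (f u)"
proof -
  have sym: "f u = sact \<iota> s (f v) \<longleftrightarrow> f v = sact \<iota> s (f u)"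
    using assms by (auto simp: sact_def involution_on_def)
  have ends: "ends G e = {u', v'} \<longleftrightarrow> u' = u \<and> v' = v \<or> u' = v \<and> v' = u" for u' v'
    using assms(5) by (auto simp: doubleton_eq_iff)
  have proper: "(s = 1 \<longrightarrow> x \<noteq> y) \<and> (s = -1 \<longrightarrow> \<iota> x \<noteq> y) \<longleftrightarrow> y \<noteq> sact \<iota> s x" for x y
    using assms(4) by (auto simp: sact_def)
  show "(\<forall>u v. ends G e = {u, v} \<longrightarrow> f v = sact \<iota> s (f u)) \<longleftrightarrow> f v = sact \<iota> s (f u)"
    using ends sym by metis
  show "(\<forall>u v. ends G e = {u, v} \<longrightarrow> (s = 1 \<longrightarrow> f u \<noteq> f v) \<and> (s = -1 \<longrightarrow> \<iota> (f u) \<noteq> f v))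
      \<longleftrightarrow> f v \<noteq> sact \<iota> s (f u)"
    unfolding proper using ends sym by metis
qed

text \<open>Write properness as a product over the edges of 1 minus the indicator of impropriety,
  expand over edge subsets, and exchange the sums.\<close>

lemma card_proper_colorings_inclusion_exclusion:
  assumes G: "signed_graph G" and S: "finite S" and inv: "involution_on S \<iota>"
  shows "real (card (proper_colorings G S \<iota>)) =
    (\<Sum>A\<in>Pow (edges G). (-1) ^ card A * real (card (equivariant_colorings (spanning_subgraph G A) S \<iota>)))"
proof -
  let ?F = "verts G \<rightarrow>\<^sub>E S"
  \<comment> \<open>Quantifying over both orders matches the body of
    \<open>equivariant_colorings\<close>, so the last step is plain unfolding.\<close>
  define bad where
    "bad f e \<longleftrightarrow> (\<forall>u v. ends G e = {u, v} \<longrightarrow> f v = sact \<iota> (sign G e) (f u))" for f :: "'a \<Rightarrow> 'c" and e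
  have fin: "finite ?F" "finite (edges G)"
    using G S by (auto simp: signed_graph_def intro: finite_PiE)
  have good: "(\<forall>u v. ends G e = {u, v} \<longrightarrow>
      (sign G e = 1 \<longrightarrow> f u \<noteq> f v) \<and> (sign G e = -1 \<longrightarrow> \<iota> (f u) \<noteq> f v)) \<longleftrightarrow> \<not> bad f e"
    if e: "e \<in> edges G" and f: "f \<in> ?F" for e f
  proof -
    obtain u v where uv: "u \<in> verts G" "v \<in> verts G" "ends G e = {u, v}"
      using G e unfolding signed_graph_def by blast
    have "f u \<in> S" "f v \<in> S" "sign G e \<in> {-1, 1}"
      using f uv e G by (auto simp: signed_graph_def)
    from equivariant_at_edge_iff[where G = G and f = f, OF inv this uv(3)]
    show ?thesis unfolding bad_def by simp
  qed
  have ind: "(\<Prod>e\<in>A. of_bool (P e)) = (of_bool (\<forall>e\<in>A. P e) :: real)"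
    if "finite A" for A :: "'b set" and P
    using that by (induction A rule: finite_induct) auto
  have count: "real (card {f \<in> ?F. Q f}) = (\<Sum>f\<in>?F. of_bool (Q f))" for Q
    using fin by (simp add: Int_def)
  have "proper_colorings G S \<iota> = {f \<in> ?F. \<forall>e\<in>edges G. \<not> bad f e}"
    unfolding proper_colorings_def using good by blast
  then have "real (card (proper_colorings G S \<iota>)) = (\<Sum>f\<in>?F. of_bool (\<forall>e\<in>edges G. \<not> bad f e))"
    by (simp only: count)
  also have "\<dots> = (\<Sum>f\<in>?F. \<Prod>e\<in>edges G. 1 - of_bool (bad f e))"
    by (simp only: ind[OF fin(2), symmetric] of_bool_not_iff)
  also have "\<dots> = (\<Sum>f\<in>?F. \<Sum>A\<in>Pow (edges G). (-1) ^ card A * of_bool (\<forall>e\<in>A. bad f e))"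
    using fin(2) by (intro sum.cong) (auto simp: prod_diff_conv_sum ind finite_subset intro!: sum.cong)
  also have "\<dots> = (\<Sum>A\<in>Pow (edges G). (-1) ^ card A * (\<Sum>f\<in>?F. of_bool (\<forall>e\<in>A. bad f e)))"
    by (subst sum.swap) (simp only: sum_distrib_left)
  also have "\<dots> = (\<Sum>A\<in>Pow (edges G).
      (-1) ^ card A * real (card (equivariant_colorings (spanning_subgraph G A) S \<iota>)))"
    by (simp only: count[symmetric] equivariant_colorings_def bad_def spanning_subgraph_simps)
  finally show ?thesis .
qed

section \<open>Evaluating the terms of the Tutte polynomial\<close>

lemma k_b_plus_k_u: "signed_graph G \<Longrightarrow> k_b G + k_u G = k_c G"
  unfolding k_b_def k_u_def k_c_def
  by (subst card_Un_disjoint[symmetric]) (auto simp: finite_components intro: arg_cong[where f = card])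

text \<open>All signs cancel because the exponents of \<open>- 1\<close> add up to \<open>a\<close> plus an even number.\<close>

lemma tutte_term_evaluation:
  fixes n t :: real
  assumes "n \<noteq> 0" "k \<le> v" "b + u = c"
  shows "(-1) ^ (v - k) * n ^ k * ((1 - n - 1) powi (int c - int k) *
      (0 - 1) powi (int a - int v + int b) * (1 - t / n - 1) powi int u) =
    (-1) ^ a * (n ^ b * t ^ u)"
proof -
  \<comment> \<open>Dividing by a power of -1 is the same as multiplying by it.\<close>
  have m: "(-1::real) powi (int a - int v + int b) = (-1) ^ a * (-1) ^ v * (-1) ^ b"
    by (simp add: power_int_add power_int_diff field_simps)
  have n: "(- n) powi (int c - int k) = (-1) ^ b * (-1) ^ u * n ^ b * n ^ u * (-1) ^ k / n ^ k"
    using assms(1)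
    by (simp add: assms(3)[symmetric] power_int_diff power_int_add power_minus[of n] field_simps)
  have tn: "(- (t / n)) ^ u = (-1) ^ u * t ^ u / n ^ u"
    by (simp add: power_minus[of "t / n"] power_divide)
  have vk: "(-1::real) ^ (v - k) = (-1) ^ v * (-1) ^ k"
    using assms(2) by (simp add: minus_one_power_iff)
  have sq: "(-1::real) ^ i * (-1) ^ i = 1" for i
    by (simp flip: power_add)
  \<comment> \<open>The signs pair into squares for \<open>v\<close>, \<open>k\<close>,
    \<open>b\<close> and \<open>u\<close>. The factor \<open>n ^ k\<close> cancels the denominator
    from \<open>n\<close>, and \<open>n ^ u\<close> the one from \<open>tn\<close>.\<close>
  have "(-1) ^ (v - k) * n ^ k * ((1 - n - 1) powi (int c - int k) *
      (0 - 1) powi (int a - int v + int b) * (1 - t / n - 1) powi int u) =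
    ((-1) ^ v * (-1) ^ v) * ((-1) ^ k * (-1) ^ k) * ((-1) ^ b * (-1) ^ b) * ((-1) ^ u * (-1) ^ u) *
    ((-1) ^ a * (n ^ b * t ^ u))"
    using assms(1) by (simp add: m n tn vk) (simp add: mult_ac)
  then show ?thesis by (simp only: sq mult_1)
qed

theorem theorem6p5:
  fixes G :: "('v, 'e) sgraph" and S :: "'s set" and \<iota> :: "'s \<Rightarrow> 's"
  assumes "signed_graph G"
    and "finite S"
    and "involution_on S \<iota>"
  defines "t \<equiv> card {s \<in> S. \<iota> s = s}"
  shows "real (card (proper_colorings G S \<iota>)) =
    (-1) ^ (card (verts G) - k_c G) * real (card S) ^ k_c G *
      signed_tutte G (1 - real (card S)) 0 (1 - real t / real (card S))"
proof (cases "S = {}")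
  \<comment> \<open>Empty \<open>S\<close> is separate because the term evaluation divides by
    \<open>card S\<close>; here the quotient in the last argument is 0 by convention.\<close>
  case True
  show ?thesis
  proof (cases "verts G = {}")
    case V: True
    then have E: "edges G = {}" using assms(1) by (auto simp: signed_graph_def)
    \<comment> \<open>Stated for all graphs without vertices, since the sum also involves a spanning
      subgraph. Both sides equal 1, the empty coloring being the only one.\<close>
    have "components H = {}" if "verts H = {}" for H :: "('v, 'e) sgraph"
      using that by (simp add: components_def)
    then have "k_c H = 0" "k_b H = 0" "k_u H = 0" if "verts H = {}" for H :: "('v, 'e) sgraph"
      using that by (simp_all add: k_c_def k_b_def k_u_def)
    then show ?thesis using V E by (simp add: proper_colorings_def signed_tutte_def)
  next
    case False
    then have "proper_colorings G S \<iota> = {}"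
      using True by (auto simp: proper_colorings_def PiE_eq_empty_iff)
    \<comment> \<open>Hence the factor \<open>real (card S) ^ k_c G\<close> is a positive power of 0
      and the right side vanishes.\<close>
    moreover have "k_c G \<noteq> 0"
      using False Union_components[of G] finite_components[OF assms(1)] by (auto simp: k_c_def)
    ultimately show ?thesis using True by simp
  qed
next
  case False
  then have n: "real (card S) \<noteq> 0" using assms(2) by simp
  have "real (card (proper_colorings G S \<iota>)) =
    (\<Sum>A\<in>Pow (edges G). (-1) ^ card A *
      real (card (equivariant_colorings (spanning_subgraph G A) S \<iota>)))"
    by (rule card_proper_colorings_inclusion_exclusion[OF assms(1-3)])
  also have "\<dots> = (\<Sum>A\<in>Pow (edges G). (-1) ^ card A *
      (real (card S) ^ k_b (spanning_subgraph G A) * real t ^ k_u (spanning_subgraph G A)))"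
    using assms(1,3)
    by (intro sum.cong)
       (auto simp: card_equivariant_colorings signed_graph_spanning_subgraph t_def)
  also have "\<dots> = (-1) ^ (card (verts G) - k_c G) * real (card S) ^ k_c G *
      signed_tutte G (1 - real (card S)) 0 (1 - real t / real (card S))"
    unfolding signed_tutte_def sum_distrib_left
    by (intro sum.cong refl tutte_term_evaluation[symmetric] n k_c_le_card_verts assms(1)
        k_b_plus_k_u signed_graph_spanning_subgraph) auto
  finally show ?thesis .
qed

end
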